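(* Let $\mathcal{V}$ be a finite ground set, $k\ge 2$ an integer with $|\mathcal{V}|\ge k$, $\mu_1,\mu_2,\alpha\in(0,1]$, and $h:\mathcal{H}(\mathcal{V})\to\mathbb{R}_{\ge 0}$ with $h(())=0$ forward-monotone. Let $S$ be the output of Algorithm 1 with parameters $k$ and $\tau=1$, and let $\mathrm{ALG}=\min_{\mathcal{V}'\subseteq\mathcal{V}(S),|\mathcal{V}'|\le1}h(S-\mathcal{V}')$ and $\mathrm{OPT}_1=\max_{S'\in\mathcal{H}(\mathcal{V}),|S'|\le k}\min_{\mathcal{V}'\subseteq\mathcal{V}(S'),|\mathcal{V}'|\le1}h(S'-\mathcal{V}')$. (i) If $h$ is backward-monotone, $\mu_1$-element-sequence-submodular and $\mu_2$-sequence-submodular, then $\mathrm{ALG}\ge \frac{a(e^b-1)}{e^b-a}\mathrm{OPT}_1$, where $a=\frac{\mu_1\mu_2}{\mu_1+1}$ and $b=\mu_1\cdot\frac{k-2}{k-1}$. (ii) If $h$ is $\alpha$-backward-monotone, $\mu_1$-element-sequence-submodular and $\mu_2$-sequence-submodular, then $\mathrm{ALG}\ge \frac{\alpha^2\mu_1\mu_2(e^{\mu_1}-1)}{(\mu_1+\alpha)e^{\mu_1}}\mathrm{OPT}_1$.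
   Context: $\mathcal{H}(\mathcal{V})$ denotes the set of all finite sequences of pairwise distinct elements of $\mathcal{V}$, including the empty sequence $()$. For $S\in\mathcal{H}(\mathcal{V})$, $\mathcal{V}(S)$ is the set of its elements and $|S|=|\mathcal{V}(S)|$. For a set $\mathcal{U}$, $S-\mathcal{U}$ is obtained from $S$ by deleting the elements of $\mathcal{U}$ keeping the order of the rest. For $S_1=(v_1,\dots,v_{m_1})$ and $S_2$ with $S_2-\mathcal{V}(S_1)=(w_1,\dots,w_{m_3})$, $S_1\oplus S_2=(v_1,\dots,v_{m_1},w_1,\dots,w_{m_3})$. $S_1\preceq S_2$ means $S_2=S_1\oplus S_3$ for some $S_3\in\mathcal{H}(\mathcal{V})$. $h(S_2\mid S_1)=h(S_1\oplus S_2)-h(S_1)$; $(v)$ is the one-element sequence. $h$ is forward-monotone if $h(S_1\oplus S_2)\ge h(S_1)$ for all $S_1,S_2$; backward-monotone if $h(S_1\oplus S_2)\ge h(S_2)$; $\alpha$-backward-monotone if $h(S_1\oplus S_2)\ge\alpha h(S_2)$ for all $S_1,S_2$; $\mu_1$-element-sequence-submodular if $h((v)\mid S_1)\ge\mu_1 h((v)\mid S_2)$ for all $v\in\mathcal{V}$ and all $S_1\preceq S_2$; $\mu_2$-sequence-submodular if $h(S_3\mid S_1)\ge\mu_2 h(S_3\mid S_2)$ for all $S_3$ and all $S_1\preceq S_2$. Algorithm 1 (parameters $k,\tau$): Step 1: from $S_1=()$, while $|S_1|<\tau$, append $v\in\arg\max_{v\in\mathcal{V}\setminus\mathcal{V}(S_1)}h((v)\mid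 S_1)$ to $S_1$. Step 2: from $S_2=()$, while $|S_2|<k-\tau$, append $v\in\arg\max_{v\in\mathcal{V}\setminus(\mathcal{V}(S_1)\cup\mathcal{V}(S_2))}h((v)\mid S_2)$ to $S_2$. Output $S=S_1\oplus S_2$; ties broken arbitrarily. *)

theory Defs
  imports Complex_Main
begin

definition seqs :: "'a set \<Rightarrow> 'a list set" where
  "seqs V = {S. distinct S \<and> set S \<subseteq> V}"

definition seq_del :: "'a list \<Rightarrow> 'a set \<Rightarrow> 'a list" where
  "seq_del S U = filter (\<lambda>x. x \<notin> U) S"

definition seq_concat :: "'a list \<Rightarrow> 'a list \<Rightarrow> 'a list" (infixl "\<oplus>" 65) where
  "S1 \<oplus> S2 = S1 @ seq_del S2 (set S1)"

definition seq_le :: "'a set \<Rightarrow> 'a list \<Rightarrow> 'a list \<Rightarrow> bool" where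
  "seq_le V S1 S2 \<longleftrightarrow> (\<exists>S3\<in>seqs V. S2 = S1 \<oplus> S3)"

text \<open>\<open>marginal h S2 S1\<close> is $h(S_2 \mid S_1)$.\<close>

definition marginal :: "('a list \<Rightarrow> real) \<Rightarrow> 'a list \<Rightarrow> 'a list \<Rightarrow> real" where
  "marginal h S2 S1 = h (S1 \<oplus> S2) - h S1"

definition forward_monotone :: "'a set \<Rightarrow> ('a list \<Rightarrow> real) \<Rightarrow> bool" where
  "forward_monotone V h \<longleftrightarrow> (\<forall>S1\<in>seqs V. \<forall>S2\<in>seqs V. h (S1 \<oplus> S2) \<ge> h S1)"

definition backward_monotone :: "'a set \<Rightarrow> ('a list \<Rightarrow> real) \<Rightarrow> bool" where
  "backward_monotone V h \<longleftrightarrow> (\<forall>S1\<in>seqs V. \<forall>S2\<in>seqs V. h (S1 \<oplus> S2) \<ge> h S2)"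

definition approx_backward_monotone :: "real \<Rightarrow> 'a set \<Rightarrow> ('a list \<Rightarrow> real) \<Rightarrow> bool" where
  "approx_backward_monotone \<alpha> V h \<longleftrightarrow>
     (\<forall>S1\<in>seqs V. \<forall>S2\<in>seqs V. h (S1 \<oplus> S2) \<ge> \<alpha> * h S2)"

definition element_sequence_submodular :: "real \<Rightarrow> 'a set \<Rightarrow> ('a list \<Rightarrow> real) \<Rightarrow> bool" where
  "element_sequence_submodular \<mu> V h \<longleftrightarrow>
     (\<forall>v\<in>V. \<forall>S1\<in>seqs V. \<forall>S2\<in>seqs V. seq_le V S1 S2 \<longrightarrow>
        marginal h [v] S1 \<ge> \<mu> * marginal h [v] S2)"

definition sequence_submodular :: "real \<Rightarrow> 'a set \<Rightarrow> ('a list \<Rightarrow> real) \<Rightarrow> bool" where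
  "sequence_submodular \<mu> V h \<longleftrightarrow>
     (\<forall>S3\<in>seqs V. \<forall>S1\<in>seqs V. \<forall>S2\<in>seqs V. seq_le V S1 S2 \<longrightarrow>
        marginal h S3 S1 \<ge> \<mu> * marginal h S3 S2)"

text \<open>\<open>greedy V h U S\<close>: the sequence \<open>S\<close> can be reached by the greedy loop that starts from the
  empty sequence and never picks elements of \<open>U\<close>. It is a relation because ties in the argmax
  may be broken arbitrarily.\<close>

inductive greedy :: "'a set \<Rightarrow> ('a list \<Rightarrow> real) \<Rightarrow> 'a set \<Rightarrow> 'a list \<Rightarrow> bool"
  for V :: "'a set" and h :: "'a list \<Rightarrow> real" and U :: "'a set" where
  greedy_Nil: "greedy V h U []"
| greedy_step: "greedy V h U S \<Longrightarrow>
    is_arg_max (\<lambda>v. marginal h [v] S) (\<lambda>v. v \<in> V - (U \<union> set S)) v \<Longrightarrow>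
    greedy V h U (S @ [v])"

text \<open>Each greedy step adds one element, so the loops with guards $|S_1| < \tau$ and
  $|S_2| < k - \tau$ stop exactly at the lengths below.\<close>

definition algorithm1_output ::
  "'a set \<Rightarrow> ('a list \<Rightarrow> real) \<Rightarrow> nat \<Rightarrow> nat \<Rightarrow> 'a list \<Rightarrow> bool" where
  "algorithm1_output V h k \<tau> S \<longleftrightarrow>
     (\<exists>S1 S2. greedy V h {} S1 \<and> length S1 = \<tau> \<and>
              greedy V h (set S1) S2 \<and> length S2 = k - \<tau> \<and>
              S = S1 \<oplus> S2)"

definition robust_value :: "('a list \<Rightarrow> real) \<Rightarrow> nat \<Rightarrow> 'a list \<Rightarrow> real" where
  "robust_value h \<tau> S = Min ((\<lambda>U. h (seq_del S U)) ` {U. U \<subseteq> set S \<and> card U \<le> \<tau>})"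

definition robust_opt :: "'a set \<Rightarrow> ('a list \<Rightarrow> real) \<Rightarrow> nat \<Rightarrow> nat \<Rightarrow> real" where
  "robust_opt V h k \<tau> = Max (robust_value h \<tau> ` {S \<in> seqs V. length S \<le> k})"

end

theory Submission
  imports Defs
begin

text \<open>
  Let \<open>S = (v\<^sub>1) \<oplus> S\<^sub>2\<close> be the output, \<open>w\<close> the first element of \<open>S\<^sub>2\<close> and
  \<open>n = k - 1\<close>. Deleting one element from an optimal sequence (\<open>v\<^sub>1\<close>, if it occurs) leaves a sequence
  \<open>T\<close> of length at most \<open>n\<close> that avoids \<open>v\<^sub>1\<close> and has \<open>h T \<ge> OPT\<^sub>1\<close>. Each step
  of the greedy loop producing \<open>S\<^sub>2\<close> therefore shrinks the gap \<open>\<alpha> h T - h S'\<close>, where \<open>S'\<close> is the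
  current sequence, by the factor \<open>1 - \<mu>\<^sub>1/n\<close>. In case (i) the gap is counted from \<open>(w)\<close>, in
  case (ii) from the empty sequence.

  If \<open>v\<close> is deleted from \<open>S\<^sub>2 = A v B\<close>, submodularity gives
  \<open>h S\<^sub>2 \<le> h (v)/\<mu>\<^sub>1 + h (A B)/\<mu>\<^sub>2\<close>, while the surviving value \<open>X = h (v\<^sub>1 A B)\<close> satisfies
  \<open>X \<ge> h (v\<^sub>1) \<ge> h (w) \<ge> h (v)\<close> and \<open>X \<ge> \<alpha> h (A B)\<close>. In case (i) the possible loss \<open>h (w)/\<mu>\<^sub>1\<close> is
  partly compensated by the head start \<open>h (w)\<close> of the greedy sequence, which yields the better factor.
\<close>

section \<open>Sequences under deletion and concatenation\<close>

lemma seqs_Nil [simp]: "[] \<in> seqs V"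
  by (simp add: seqs_def)

lemma seqs_append_iff:
  "A @ B \<in> seqs V \<longleftrightarrow> A \<in> seqs V \<and> B \<in> seqs V \<and> set A \<inter> set B = {}"
  by (auto simp: seqs_def)

lemma seqs_Cons_iff: "x # A \<in> seqs V \<longleftrightarrow> x \<in> V \<and> x \<notin> set A \<and> A \<in> seqs V"
  by (auto simp: seqs_def)

lemma seq_concat_in_seqs: "A \<in> seqs V \<Longrightarrow> B \<in> seqs V \<Longrightarrow> A \<oplus> B \<in> seqs V"
  by (auto simp: seqs_def seq_concat_def seq_del_def)

lemma seq_del_in_seqs: "A \<in> seqs V \<Longrightarrow> seq_del A U \<in> seqs V"
  by (auto simp: seqs_def seq_del_def)

lemma seq_del_disjoint: "set A \<inter> U = {} \<Longrightarrow> seq_del A U = A"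
  unfolding seq_del_def by (rule filter_True) auto

lemma seq_concat_disjoint: "set A \<inter> set B = {} \<Longrightarrow> A \<oplus> B = A @ B"
  by (simp add: seq_concat_def seq_del_disjoint Int_commute)

lemma seq_concat_Nil [simp]: "[] \<oplus> A = A" "A \<oplus> [] = A"
  by (simp_all add: seq_concat_def seq_del_def)

lemma seq_concat_member: "v \<in> set A \<Longrightarrow> A \<oplus> [v] = A"
  by (simp add: seq_concat_def seq_del_def)

text \<open>If \<open>v\<close> already lies in \<open>A\<close>, both sides drop it. This case
  occurs when the competitor overlaps the current greedy sequence.\<close>

lemma seq_concat_snoc: "v \<notin> set T \<Longrightarrow> A \<oplus> (T @ [v]) = (A \<oplus> T) \<oplus> [v]"
  by (auto simp: seq_concat_def seq_del_def)

section \<open>Robust value and robust optimum\<close>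

lemma finite_bounded_seqs: "finite V \<Longrightarrow> finite {S \<in> seqs V. length S \<le> k}"
  by (rule finite_subset[OF _ finite_lists_length_le[of V k]]) (auto simp: seqs_def)

lemma finite_deletions: "finite {U. U \<subseteq> set S \<and> card U \<le> \<tau>}"
  by (rule finite_subset[of _ "Pow (set S)"]) auto

lemma robust_value_le:
  assumes "U \<subseteq> set S" "card U \<le> \<tau>"
  shows "robust_value h \<tau> S \<le> h (seq_del S U)"
  unfolding robust_value_def using assms
  by (intro Min_le finite_imageI finite_deletions) auto

lemma robust_value_geI:
  assumes "\<And>U. U \<subseteq> set S \<Longrightarrow> card U \<le> \<tau> \<Longrightarrow> c \<le> h (seq_del S U)"
  shows "c \<le> robust_value h \<tau> S"
proof -
  have "{} \<in> {U. U \<subseteq> set S \<and> card U \<le> \<tau>}"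
    by simp
  then have "(\<lambda>U. h (seq_del S U)) ` {U. U \<subseteq> set S \<and> card U \<le> \<tau>} \<noteq> {}"
    by blast
  then show ?thesis
    unfolding robust_value_def using assms
    by (intro Min.boundedI finite_imageI finite_deletions) auto
qed

text \<open>The robust optimum is a minimum over single deletions, so any one deletion from an
  optimal sequence keeps at least that value. The deletion is spent on excluding \<open>v\<close>,
  which makes the rest a legal competitor for a greedy loop that may not use
  \<open>v\<close>.\<close>

lemma robust_opt_avoiding:
  assumes "finite V" "k \<ge> 1"
  obtains T where "T \<in> seqs V" "v \<notin> set T" "length T \<le> k - 1" "robust_opt V h k 1 \<le> h T"
proof -
  have "robust_opt V h k 1 \<in> robust_value h 1 ` {S \<in> seqs V. length S \<le> k}"
    unfolding robust_opt_def using finite_bounded_seqs[OF assms(1)]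
    by (intro Max_in) (auto intro: exI[of _ "[]"])
  then obtain S where S: "S \<in> seqs V" "length S \<le> k" "robust_opt V h k 1 = robust_value h 1 S"
    by auto
  \<comment> \<open>If \<open>v\<close> is absent, the head is deleted instead, because the length
    has to drop to \<open>k - 1\<close> in either case.\<close>
  define U where "U = (if v \<in> set S then {v} else if S = [] then {} else {hd S})"
  have U: "U \<subseteq> set S" "card U \<le> 1"
    by (auto simp: U_def)
  have "distinct S"
    using S by (simp add: seqs_def)
  then have "length (seq_del S U) = card (set S - U)"
    unfolding seq_del_def by (simp add: distinct_card[symmetric] set_diff_eq)
  also have "\<dots> \<le> k - 1"
  proof (cases "S = []")
    case False
    then have "card U = 1"
      by (auto simp: U_def)
    then show ?thesis
      using U S(2) card_Diff_subset[of U "set S"] \<open>distinct S\<close> finite_subset[OF U(1)]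
      by (auto simp: distinct_card)
  qed simp
  finally have "length (seq_del S U) \<le> k - 1" .
  moreover have "v \<notin> set (seq_del S U)"
    by (auto simp: U_def seq_del_def)
  ultimately show ?thesis
    using that[of "seq_del S U"] seq_del_in_seqs[OF S(1)] robust_value_le[OF U] S(3) by auto
qed

section \<open>The greedy loop and an exponential bound\<close>

lemma greedy_snocD:
  assumes "greedy V h U (S @ [v])"
  shows "greedy V h U S" "is_arg_max (\<lambda>v. marginal h [v] S) (\<lambda>v. v \<in> V - (U \<union> set S)) v"
proof -
  from assms have "greedy V h U S \<and>
      is_arg_max (\<lambda>v. marginal h [v] S) (\<lambda>v. v \<in> V - (U \<union> set S)) v"
    by (cases rule: greedy.cases) simp_all
  then show "greedy V h U S"
    and "is_arg_max (\<lambda>v. marginal h [v] S) (\<lambda>v. v \<in> V - (U \<union> set S)) v"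
    by blast+
qed

lemma greedy_in_seqs: "greedy V h U S \<Longrightarrow> S \<in> seqs (V - U)"
  by (induction rule: greedy.induct) (auto simp: seqs_def is_arg_max_def)

lemma greedy_hd_max:
  assumes "greedy V h U S" "S \<noteq> []" "x \<in> V - U"
  shows "h [x] \<le> h [hd S]"
  using assms
proof (induction rule: greedy.induct)
  case (greedy_step S v)
  then show ?case
    by (cases "S = []") (auto simp: is_arg_max_linorder marginal_def)
qed simp

lemma seqs_mono: "U \<subseteq> V \<Longrightarrow> seqs U \<subseteq> seqs V"
  by (auto simp: seqs_def)

lemma one_minus_power_le_exp:
  fixes x :: real
  assumes "x \<le> 1"
  shows "(1 - x) ^ m \<le> exp (- (real m * x))"
proof -
  have "(1 - x) ^ m \<le> exp (- x) ^ m"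
    using assms exp_ge_add_one_self[of "- x"] by (intro power_mono) auto
  then show ?thesis
    by (simp flip: exp_of_nat_mult)
qed

text \<open>Exact backward monotonicity is the instance \<alpha> = 1, so one greedy analysis serves
  both ratios.\<close>

locale submodular_seq_fun =
  fixes V :: "'a set" and h :: "'a list \<Rightarrow> real" and \<mu>1 \<mu>2 \<alpha> :: real
  assumes \<mu>1: "0 < \<mu>1" "\<mu>1 \<le> 1" and \<mu>2: "0 < \<mu>2" "\<mu>2 \<le> 1" and \<alpha>: "0 < \<alpha>" "\<alpha> \<le> 1"
    and nonneg: "T \<in> seqs V \<Longrightarrow> 0 \<le> h T" and h_Nil: "h [] = 0"
    and forward: "forward_monotone V h"
    and backward: "approx_backward_monotone \<alpha> V h"
    and elem_submodular: "element_sequence_submodular \<mu>1 V h"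
    and seq_submodular: "sequence_submodular \<mu>2 V h"
begin

section \<open>Marginal gains and the progress of the greedy sequence\<close>

lemma prefix_le: "A @ B \<in> seqs V \<Longrightarrow> h A \<le> h (A @ B)"
  using forward by (auto simp: forward_monotone_def seqs_append_iff simp flip: seq_concat_disjoint)

lemma suffix_le: "A @ B \<in> seqs V \<Longrightarrow> \<alpha> * h B \<le> h (A @ B)"
  using backward
  by (auto simp: approx_backward_monotone_def seqs_append_iff simp flip: seq_concat_disjoint)

lemma elem_marginal_concat:
  assumes "A \<in> seqs V" "B \<in> seqs V" "v \<in> V"
  shows "\<mu>1 * marginal h [v] (A \<oplus> B) \<le> marginal h [v] A"
  using elem_submodular assms seq_concat_in_seqs[OF assms(1,2)]
  unfolding element_sequence_submodular_def seq_le_def by blast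

lemma seq_marginal_concat:
  assumes "A \<in> seqs V" "B \<in> seqs V" "C \<in> seqs V"
  shows "\<mu>2 * marginal h C (A \<oplus> B) \<le> marginal h C A"
  using seq_submodular assms seq_concat_in_seqs[OF assms(1,2)]
  unfolding sequence_submodular_def seq_le_def by blast

text \<open>Appending \<open>T\<close> element by element telescopes the total gain, and element
  submodularity bounds each increment by its gain at \<open>A\<close> divided by \<mu>1.\<close>

lemma marginal_le_sum_of_gains:
  assumes "A \<in> seqs V" "T \<in> seqs V" "\<And>x. x \<in> set T \<Longrightarrow> marginal h [x] A \<le> g"
  shows "\<mu>1 * (h (A \<oplus> T) - h A) \<le> real (length T) * g"
  using assms(2,3)
proof (induction T rule: rev_induct)
  case (snoc x T)
  then have T: "T \<in> seqs V" "x \<in> V" "x \<notin> set T"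
    by (auto simp: seqs_append_iff seqs_Cons_iff)
  have "\<mu>1 * marginal h [x] (A \<oplus> T) \<le> g"
    using elem_marginal_concat[OF assms(1) T(1,2)] snoc.prems(2)[of x] by simp
  then have "\<mu>1 * (h (A \<oplus> (T @ [x])) - h (A \<oplus> T)) \<le> g"
    by (simp add: marginal_def seq_concat_snoc[OF T(3)])
  moreover have "\<mu>1 * (h (A \<oplus> T) - h A) \<le> real (length T) * g"
    using snoc T by simp
  ultimately show ?case
    by (simp add: algebra_simps)
qed simp

text \<open>An averaging argument: by backward monotonicity, appending all of \<open>T\<close> to
  \<open>S\<close> gains at least the current gap. This gain is shared by at most \<open>n\<close>
  elements, none of which beats the greedy choice.\<close>

lemma greedy_step_gap:
  assumes "greedy V h U (S @ [v])" "T \<in> seqs (V - U)" "length T \<le> n" "0 < n"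
  shows "\<alpha> * h T - h (S @ [v]) \<le> (1 - \<mu>1 / real n) * (\<alpha> * h T - h S)"
proof -
  note arg_max = greedy_snocD(2)[OF assms(1)]
  have T: "T \<in> seqs V" and Sv: "S @ [v] \<in> seqs V"
    using assms(2) greedy_in_seqs[OF assms(1)] seqs_mono[of "V - U" V] by auto
  then have S: "S \<in> seqs V" and v: "v \<notin> set S"
    by (auto simp: seqs_append_iff)
  define g where "g = marginal h [v] S"
  have g: "g = h (S @ [v]) - h S"
    using v by (simp add: g_def marginal_def seq_concat_disjoint)
  \<comment> \<open>Nonnegativity covers elements of \<open>T\<close> already in \<open>S\<close>,
    whose gain is zero, and later allows \<open>length T\<close> to be replaced by
    \<open>n\<close>.\<close>
  have g0: "0 \<le> g"
    using prefix_le[OF Sv] g by simp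
  have "marginal h [x] S \<le> g" if "x \<in> set T" for x
  proof (cases "x \<in> set S")
    case True
    then show ?thesis
      using g0 by (simp add: marginal_def seq_concat_member)
  next
    case False
    then show ?thesis
      using arg_max that assms(2) by (auto simp: is_arg_max_linorder g_def seqs_def)
  qed
  from marginal_le_sum_of_gains[OF S T this]
  have "\<mu>1 * (h (S \<oplus> T) - h S) \<le> real (length T) * g" .
  also have "\<dots> \<le> real n * g"
    using assms(3) g0 by (intro mult_right_mono) auto
  finally have "\<mu>1 * (h (S \<oplus> T) - h S) \<le> real n * g" .
  moreover have "\<mu>1 * (\<alpha> * h T - h S) \<le> \<mu>1 * (h (S \<oplus> T) - h S)"
    using backward S T \<mu>1 unfolding approx_backward_monotone_def by (intro mult_left_mono) auto
  ultimately have "\<mu>1 * (\<alpha> * h T - h S) \<le> real n * g"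
    by linarith
  then have "\<mu>1 / real n * (\<alpha> * h T - h S) \<le> g"
    using assms(4) by (simp add: field_simps)
  then show ?thesis
    using g by (simp add: left_diff_distrib)
qed

lemma greedy_gap:
  assumes "greedy V h U (A @ B)" "T \<in> seqs (V - U)" "length T \<le> n" "0 < n"
  shows "\<alpha> * h T - h (A @ B) \<le> (1 - \<mu>1 / real n) ^ length B * (\<alpha> * h T - h A)"
  using assms(1)
proof (induction B rule: rev_induct)
  case (snoc v B)
  have "\<mu>1 / real n \<le> 1"
    using \<mu>1 assms(4) by (simp add: divide_le_eq)
  have "\<alpha> * h T - h ((A @ B) @ [v]) \<le> (1 - \<mu>1 / real n) * (\<alpha> * h T - h (A @ B))"
    using greedy_step_gap[of U "A @ B" v T n] snoc.prems assms by simp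
  also have "\<dots> \<le> (1 - \<mu>1 / real n) * ((1 - \<mu>1 / real n) ^ length B * (\<alpha> * h T - h A))"
    using snoc greedy_snocD(1)[of V h U "A @ B" v] \<open>\<mu>1 / real n \<le> 1\<close>
    by (intro mult_left_mono) auto
  finally show ?case
    by (simp add: mult_ac)
qed simp

text \<open>Replacing the power by an exponential requires a nonnegative initial gap. If the gap is
  negative, \<open>A\<close> alone already exceeds the target and forward monotonicity suffices. The
  prefix \<open>A\<close> is the head start: \<open>[w]\<close> for the first ratio, empty for the
  second.\<close>

lemma greedy_value:
  assumes "greedy V h U (A @ B)" "T \<in> seqs (V - U)" "length T \<le> n" "0 < n"
    and "c = exp (- (real (length B) * (\<mu>1 / real n)))"
  shows "(1 - c) * (\<alpha> * h T) + c * h A \<le> h (A @ B)"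
proof (cases "h A \<le> \<alpha> * h T")
  case True
  have "\<mu>1 / real n \<le> 1"
    using \<mu>1 assms(4) by (simp add: divide_le_eq)
  have "\<alpha> * h T - h (A @ B) \<le> (1 - \<mu>1 / real n) ^ length B * (\<alpha> * h T - h A)"
    using assms by (intro greedy_gap)
  also have "\<dots> \<le> c * (\<alpha> * h T - h A)"
    using True one_minus_power_le_exp[OF \<open>\<mu>1 / real n \<le> 1\<close>] assms(5)
    by (intro mult_right_mono) auto
  finally show ?thesis
    by (simp add: algebra_simps)
next
  case False
  have "c \<le> 1"
    using assms(5) \<mu>1 by simp
  then have "(1 - c) * (\<alpha> * h T) \<le> (1 - c) * h A"
    using False by (intro mult_left_mono) auto
  moreover have "h A \<le> h (A @ B)"
    using greedy_in_seqs[OF assms(1)] seqs_mono[of "V - U" V] by (intro prefix_le) auto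
  ultimately show ?thesis
    by (simp add: algebra_simps)
qed

text \<open>The value splits into \<open>h A\<close>, the gain of \<open>v\<close> after
  \<open>A\<close>, and the gain of \<open>B\<close> after \<open>A @ [v]\<close>. The two kinds of
  submodularity bound the gains; the term \<open>- h A / \<mu>2\<close> from the last one absorbs
  \<open>h A\<close> because \<mu>2 \<le> 1.\<close>

lemma value_le_after_deletion:
  assumes "A @ v # B \<in> seqs V"
  shows "h (A @ v # B) \<le> h [v] / \<mu>1 + h (A @ B) / \<mu>2"
proof -
  have seqs: "A \<in> seqs V" "B \<in> seqs V" "[v] \<in> seqs V" "v \<in> V"
    and disj: "set A \<inter> set B = {}" "v \<notin> set A" "v \<notin> set B"
    using assms by (auto simp: seqs_append_iff seqs_Cons_iff)
  have "\<mu>1 * marginal h [v] ([] \<oplus> A) \<le> marginal h [v] []"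
    using seqs by (intro elem_marginal_concat) auto
  then have v: "h (A @ [v]) - h A \<le> h [v] / \<mu>1"
    using disj \<mu>1 by (simp add: marginal_def seq_concat_disjoint h_Nil field_simps)
  have "\<mu>2 * marginal h B (A \<oplus> [v]) \<le> marginal h B A"
    using seqs by (intro seq_marginal_concat)
  then have "\<mu>2 * (h (A @ v # B) - h (A @ [v])) \<le> h (A @ B) - h A"
    using disj by (simp add: marginal_def seq_concat_disjoint)
  then have B: "h (A @ v # B) - h (A @ [v]) \<le> h (A @ B) / \<mu>2 - h A / \<mu>2"
    using \<mu>2 by (simp add: field_simps)
  have "h A \<le> h A / \<mu>2"
    using nonneg[OF seqs(1)] \<mu>2 by (simp add: le_divide_eq mult_left_le)
  then show ?thesis
    using v B by linarith
qed

section \<open>Deletions from the output of the algorithm\<close>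

lemma algorithm1_robust_cases:
  assumes "algorithm1_output V h k 1 S" "k \<ge> 2" "finite V"
  obtains U w B T where
    "greedy V h U (w # B)" "T \<in> seqs (V - U)" "length T \<le> k - 1" "length B = k - 2"
    "robust_opt V h k 1 \<le> h T"
    "\<And>W. W \<subseteq> set S \<Longrightarrow> card W \<le> 1 \<Longrightarrow> \<alpha> * h (w # B) \<le> h (seq_del S W) \<or>
       (h [w] \<le> h (seq_del S W) \<and> h (w # B) \<le> h [w] / \<mu>1 + h (seq_del S W) / (\<alpha> * \<mu>2))"
proof -
  obtain S1 S2 where S1: "greedy V h {} S1" "length S1 = 1"
    and S2: "greedy V h (set S1) S2" "length S2 = k - 1" and S: "S = S1 \<oplus> S2"
    using assms(1) unfolding algorithm1_output_def by auto
  obtain v1 where v1: "S1 = [v1]"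
    using S1(2) by (auto simp: length_Suc_conv)
  obtain w B where wB: "S2 = w # B"
    using S2(2) assms(2) by (cases S2) auto
  have S2_seq: "S2 \<in> seqs (V - {v1})"
    using greedy_in_seqs[OF S2(1)] v1 by simp
  then have v1_S2: "v1 \<notin> set S2" and w: "w \<in> V"
    by (auto simp: seqs_def wB)
  have S_eq: "S = v1 # S2"
    using v1_S2 by (simp add: S v1 seq_concat_disjoint)
  have S_seq: "v1 # S2 \<in> seqs V"
    using greedy_in_seqs[OF S1(1)] S2_seq v1 by (auto simp: seqs_def)
  have S2_le: "\<alpha> * h S2 \<le> h (v1 # S2)"
    using suffix_le[of "[v1]" S2] S_seq by simp
  have S2_nonneg: "0 \<le> h S2"
    using S_seq by (intro nonneg) (simp add: seqs_Cons_iff)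
  \<comment> \<open>Deleting nothing or \<open>v1\<close> leads to the first alternative, deleting
    an element of \<open>S2\<close> to the second.\<close>
  have dist: "\<alpha> * h S2 \<le> h (seq_del S W) \<or>
      (h [w] \<le> h (seq_del S W) \<and> h S2 \<le> h [w] / \<mu>1 + h (seq_del S W) / (\<alpha> * \<mu>2))"
    if W: "W \<subseteq> set S" "card W \<le> 1" for W
  proof -
    from W have "finite W"
      using finite_subset by blast
    with W(2) consider "W = {}" | x where "W = {x}"
      by (metis One_nat_def card_0_eq card_1_singletonE le_Suc_eq le_zero_eq)
    then show ?thesis
    proof cases
      case 1
      then show ?thesis
        using S2_le by (simp add: S_eq seq_del_disjoint)
    next
      case (2 x)
      show ?thesis
      proof (cases "x = v1")
        case True
        then have "seq_del S W = S2"
          using 2 v1_S2 seq_del_disjoint[of S2 "{v1}"] by (simp add: S_eq seq_del_def)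
        then show ?thesis
          using S2_nonneg \<alpha> by (simp add: mult_left_le_one_le)
      next
        case False
        then have "x \<in> set S2"
          using 2 W by (auto simp: S_eq)
        then obtain C D where CD: "S2 = C @ x # D"
          by (auto dest: split_list)
        have del: "seq_del S W = v1 # C @ D"
          using 2 S_seq CD False seq_del_disjoint[of C "{x}"] seq_del_disjoint[of D "{x}"]
          by (auto simp: S_eq seq_del_def seqs_def)
        have seqs: "v1 # C @ D \<in> seqs V" "C @ x # D \<in> seqs V"
          using S_seq CD by (auto simp: seqs_def)
        \<comment> \<open>\<open>v1\<close> is the best singleton overall and \<open>w\<close> the
          best one apart from \<open>v1\<close>, so the surviving \<open>v1\<close> pays for any
          deleted element.\<close>
        have "h [w] \<le> h [v1]"
          using greedy_hd_max[OF S1(1)] w v1 by simp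
        also have "\<dots> \<le> h (v1 # C @ D)"
          using prefix_le[of "[v1]" "C @ D"] seqs by simp
        finally have 3: "h [w] \<le> h (v1 # C @ D)" .
        have "h [x] \<le> h [w]"
          using greedy_hd_max[OF S2(1), of x] \<open>x \<in> set S2\<close> S2_seq v1 wB by (auto simp: seqs_def)
        then have "h [x] / \<mu>1 \<le> h [w] / \<mu>1"
          using \<mu>1 by (simp add: divide_right_mono)
        moreover have "h (C @ D) / \<mu>2 \<le> h (v1 # C @ D) / (\<alpha> * \<mu>2)"
          using suffix_le[of "[v1]" "C @ D"] seqs \<alpha> \<mu>2 by (simp add: field_simps)
        ultimately have "h S2 \<le> h [w] / \<mu>1 + h (v1 # C @ D) / (\<alpha> * \<mu>2)"
          using value_le_after_deletion[OF seqs(2)] CD by simp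
        then show ?thesis
          using 3 del by simp
      qed
    qed
  qed
  obtain T where T: "T \<in> seqs V" "v1 \<notin> set T" "length T \<le> k - 1" "robust_opt V h k 1 \<le> h T"
    using robust_opt_avoiding[OF assms(3), of k] assms(2) by auto
  show ?thesis
    by (rule that[of "{v1}" w B T]) (use S2 wB v1 T dist in \<open>auto simp: seqs_def\<close>)
qed

section \<open>The two approximation ratios\<close>

lemma algorithm1_ratio_exact_backward:
  assumes "algorithm1_output V h k 1 S" "k \<ge> 2" "finite V" "\<alpha> = 1"
    and a: "a = \<mu>1 * \<mu>2 / (\<mu>1 + 1)" and b: "b = \<mu>1 * ((real k - 2) / (real k - 1))"
  shows "a * (exp b - 1) / (exp b - a) * robust_opt V h k 1 \<le> robust_value h 1 S"
proof (rule robust_value_geI)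
  fix W assume W: "W \<subseteq> set S" "card W \<le> 1"
  define X where "X = h (seq_del S W)"
  obtain U w B T where
    greedy: "greedy V h U (w # B)" and T: "T \<in> seqs (V - U)" "length T \<le> k - 1"
    and B: "length B = k - 2" and opt: "robust_opt V h k 1 \<le> h T"
    and X: "\<alpha> * h (w # B) \<le> X \<or>
       (h [w] \<le> X \<and> h (w # B) \<le> h [w] / \<mu>1 + X / (\<alpha> * \<mu>2))"
    using algorithm1_robust_cases[OF assms(1-3)] W unfolding X_def by metis
  define c where "c = exp (- b)"
  \<comment> \<open>Only the \<open>k - 2\<close> steps after \<open>w\<close> count, while the
    competitor has up to \<open>k - 1\<close> elements; hence the fraction in
    \<open>b\<close>.\<close>
  have "real (k - 2) * (\<mu>1 / real (k - 1)) = b"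
    using assms(2) by (simp add: b of_nat_diff)
  then have G: "(1 - c) * h T + c * h [w] \<le> h (w # B)"
    using greedy_value[of U "[w]" B T "k - 1" c] greedy T B assms(2,4) by (simp add: c_def)
  have w0: "0 \<le> h [w]" and T0: "0 \<le> h T"
    using greedy_in_seqs[OF greedy] T by (auto intro!: nonneg simp: seqs_def)
  have "0 \<le> b"
    using assms(2) \<mu>1 by (simp add: b)
  then have c: "0 < c" "c \<le> 1"
    by (simp_all add: c_def)
  have "\<mu>1 * \<mu>2 \<le> \<mu>1"
    using \<mu>1 \<mu>2 by (simp add: mult_left_le)
  then have "2 * (\<mu>1 * \<mu>2) \<le> \<mu>1 + 1"
    using \<mu>1 by linarith
  then have a_bounds: "0 < a" "a \<le> 1 / 2"
    using \<mu>1 \<mu>2 by (simp_all add: a divide_le_eq)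
  have "a * c \<le> a"
    using a_bounds c by (simp add: mult_left_le)
  \<comment> \<open>This is the claim after multiplying numerator and denominator of the ratio by
    \<open>c = exp (- b)\<close> and clearing the denominator.\<close>
  have key: "a * (1 - c) * h T \<le> (1 - a * c) * X"
    using X
  proof
    assume "\<alpha> * h (w # B) \<le> X"
    then have X_ge: "(1 - c) * h T \<le> X"
      using G mult_nonneg_nonneg[OF less_imp_le[OF c(1)] w0] assms(4) by simp
    moreover have "0 \<le> (1 - c) * h T"
      using T0 c by simp
    ultimately have "0 \<le> X"
      by linarith
    \<comment> \<open>Here \<open>a \<le> 1 / 2\<close> enters:
      \<open>a + a * c \<le> 2 * a \<le> 1\<close>.\<close>
    then have "a * X \<le> (1 - a * c) * X"
      using a_bounds \<open>a * c \<le> a\<close> by (intro mult_right_mono) linarith+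
    moreover have "a * ((1 - c) * h T) \<le> a * X"
      using X_ge a_bounds by (intro mult_left_mono) auto
    ultimately show ?thesis
      by (simp add: mult.assoc)
  next
    assume asm: "h [w] \<le> X \<and> h (w # B) \<le> h [w] / \<mu>1 + X / (\<alpha> * \<mu>2)"
    have "1 \<le> 1 / \<mu>1"
      using \<mu>1 by simp
    \<comment> \<open>The head start \<open>c * h [w]\<close> is subtracted from the loss
      \<open>h [w] / \<mu>1\<close>. The coefficient stays nonnegative, so \<open>h [w]\<close> may
      be replaced by \<open>X\<close>.\<close>
    have "(1 - c) * h T \<le> (1 / \<mu>1 - c) * h [w] + X / \<mu>2"
      using asm G assms(4) by (simp add: algebra_simps)
    also have "\<dots> \<le> (1 / \<mu>1 - c) * X + X / \<mu>2"
      using asm \<open>1 \<le> 1 / \<mu>1\<close> c by (intro add_right_mono mult_left_mono) auto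
    finally have "a * ((1 - c) * h T) \<le> a * ((1 / \<mu>1 - c) * X + X / \<mu>2)"
      using a_bounds by (intro mult_left_mono) auto
    also have "\<dots> = (a / \<mu>1 + a / \<mu>2 - a * c) * X"
      by (simp add: algebra_simps)
    \<comment> \<open>This explains the choice of \<open>a\<close>: the sum is at most 1 since
      \<mu>2 \<le> 1.\<close>
    also have "a / \<mu>1 + a / \<mu>2 = (\<mu>1 + \<mu>2) / (\<mu>1 + 1)"
      using \<mu>1 \<mu>2 by (simp add: a add_divide_distrib add.commute)
    also have "((\<mu>1 + \<mu>2) / (\<mu>1 + 1) - a * c) * X \<le> (1 - a * c) * X"
      using \<mu>1 \<mu>2 w0 asm by (intro mult_right_mono) auto
    finally show ?thesis
      by (simp add: mult.assoc)
  qed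
  have pos: "0 < 1 - a * c"
    using a_bounds \<open>a * c \<le> a\<close> by linarith
  have "exp b = 1 / c"
    by (simp add: c_def exp_minus field_simps)
  then have "exp b - 1 = (1 - c) / c" "exp b - a = (1 - a * c) / c"
    using c by (simp_all add: field_simps)
  then have ratio: "a * (exp b - 1) / (exp b - a) = a * (1 - c) / (1 - a * c)"
    using c by simp
  have "a * (1 - c) / (1 - a * c) * robust_opt V h k 1 \<le> a * (1 - c) / (1 - a * c) * h T"
    using opt a_bounds c pos by (intro mult_left_mono) auto
  also have "\<dots> \<le> X"
    using key pos by (simp add: field_simps)
  finally show "a * (exp b - 1) / (exp b - a) * robust_opt V h k 1 \<le> h (seq_del S W)"
    by (simp add: ratio X_def)
qed

lemma algorithm1_ratio_approx_backward:
  assumes "algorithm1_output V h k 1 S" "k \<ge> 2" "finite V"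
  shows "\<alpha>\<^sup>2 * \<mu>1 * \<mu>2 * (exp \<mu>1 - 1) / ((\<mu>1 + \<alpha>) * exp \<mu>1) * robust_opt V h k 1
    \<le> robust_value h 1 S"
proof (rule robust_value_geI)
  fix W assume W: "W \<subseteq> set S" "card W \<le> 1"
  define X where "X = h (seq_del S W)"
  obtain U w B T where
    greedy: "greedy V h U (w # B)" and T: "T \<in> seqs (V - U)" "length T \<le> k - 1"
    and B: "length B = k - 2" and opt: "robust_opt V h k 1 \<le> h T"
    and X: "\<alpha> * h (w # B) \<le> X \<or>
       (h [w] \<le> X \<and> h (w # B) \<le> h [w] / \<mu>1 + X / (\<alpha> * \<mu>2))"
    using algorithm1_robust_cases[OF assms] W unfolding X_def by metis
  define c where "c = exp (- \<mu>1)"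
  have len: "length (w # B) = k - 1"
    using B assms(2) by simp
  \<comment> \<open>Starting from the empty sequence, \<open>w\<close> counts as a step too. All
    \<open>k - 1\<close> steps together give exactly the exponent \<mu>1.\<close>
  have "real (length (w # B)) * (\<mu>1 / real (k - 1)) = \<mu>1"
    using assms(2) by (simp only: len) simp
  then have G: "(1 - c) * (\<alpha> * h T) \<le> h (w # B)"
    using greedy_value[of U "[]" "w # B" T "k - 1" c] greedy T assms(2)
    by (simp only: c_def h_Nil append_Nil) simp
  have w0: "0 \<le> h [w]" and wB0: "0 \<le> h (w # B)"
    using greedy_in_seqs[OF greedy] by (auto intro!: nonneg simp: seqs_def)
  have c: "0 < c" "c \<le> 1"
    using \<mu>1 by (simp_all add: c_def)
  \<comment> \<open>The factor \<open>\<alpha> * \<mu>1 * \<mu>2\<close> clears the denominators in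
    \<open>X / \<mu>1 + X / (\<alpha> * \<mu>2)\<close>. The resulting \<mu>1 + \<alpha>\<mu>2 is
    relaxed to \<mu>1 + \<alpha>, which also dominates \<mu>1\<mu>2 in the first
    alternative.\<close>
  have key: "\<alpha> * \<mu>1 * \<mu>2 * h (w # B) \<le> (\<mu>1 + \<alpha>) * X"
    using X
  proof
    assume asm: "\<alpha> * h (w # B) \<le> X"
    then have "0 \<le> X"
      using mult_nonneg_nonneg[OF less_imp_le[OF \<alpha>(1)] wB0] by linarith
    have "\<mu>1 * \<mu>2 * (\<alpha> * h (w # B)) \<le> \<mu>1 * \<mu>2 * X"
      using asm \<mu>1 \<mu>2 by (intro mult_left_mono) auto
    also have "\<dots> \<le> (\<mu>1 + \<alpha>) * X"
      using \<mu>1 \<mu>2 \<alpha> \<open>0 \<le> X\<close> by (intro mult_right_mono) (auto simp: mult_left_le add_increasing2)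
    finally show ?thesis
      by (simp add: mult_ac)
  next
    assume asm: "h [w] \<le> X \<and> h (w # B) \<le> h [w] / \<mu>1 + X / (\<alpha> * \<mu>2)"
    then have "h [w] / \<mu>1 \<le> X / \<mu>1"
      using \<mu>1 by (simp add: divide_right_mono)
    then have "h (w # B) \<le> X / \<mu>1 + X / (\<alpha> * \<mu>2)"
      using asm by simp
    then have "\<alpha> * \<mu>1 * \<mu>2 * h (w # B) \<le> \<alpha> * \<mu>1 * \<mu>2 * (X / \<mu>1 + X / (\<alpha> * \<mu>2))"
      using \<alpha> \<mu>1 \<mu>2 by (intro mult_left_mono) auto
    also have "\<dots> = (\<mu>1 + \<alpha> * \<mu>2) * X"
      using \<alpha> \<mu>1 \<mu>2 by (simp add: field_simps)
    also have "\<dots> \<le> (\<mu>1 + \<alpha>) * X"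
      using w0 asm \<alpha> \<mu>2 by (intro mult_right_mono) (auto simp: mult_left_le)
    finally show ?thesis .
  qed
  have ratio: "\<alpha>\<^sup>2 * \<mu>1 * \<mu>2 * (exp \<mu>1 - 1) / ((\<mu>1 + \<alpha>) * exp \<mu>1)
      = \<alpha> * \<mu>1 * \<mu>2 * ((1 - c) * \<alpha>) / (\<mu>1 + \<alpha>)"
    using \<mu>1 \<alpha> by (simp add: c_def exp_minus field_simps power2_eq_square)
  have "\<alpha> * \<mu>1 * \<mu>2 * ((1 - c) * \<alpha>) / (\<mu>1 + \<alpha>) * robust_opt V h k 1
      \<le> \<alpha> * \<mu>1 * \<mu>2 * ((1 - c) * \<alpha>) / (\<mu>1 + \<alpha>) * h T"
    using opt c \<alpha> \<mu>1 \<mu>2 by (intro mult_left_mono) auto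
  also have "\<dots> = \<alpha> * \<mu>1 * \<mu>2 * ((1 - c) * (\<alpha> * h T)) / (\<mu>1 + \<alpha>)"
    by simp
  also have "\<dots> \<le> \<alpha> * \<mu>1 * \<mu>2 * h (w # B) / (\<mu>1 + \<alpha>)"
    using G \<alpha> \<mu>1 \<mu>2 by (intro divide_right_mono mult_left_mono) auto
  also have "\<dots> \<le> X"
    using key \<alpha> \<mu>1 by (simp add: field_simps)
  finally show "\<alpha>\<^sup>2 * \<mu>1 * \<mu>2 * (exp \<mu>1 - 1) / ((\<mu>1 + \<alpha>) * exp \<mu>1) * robust_opt V h k 1
      \<le> h (seq_del S W)"
    by (simp add: ratio X_def)
qed

end

theorem theorem4:
  fixes V :: "'a set" and h :: "'a list \<Rightarrow> real" and k :: nat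
    and \<mu>1 \<mu>2 \<alpha> :: real and S :: "'a list"
  assumes "finite V" and "k \<ge> 2" and "card V \<ge> k"
    and "0 < \<mu>1" and "\<mu>1 \<le> 1" and "0 < \<mu>2" and "\<mu>2 \<le> 1" and "0 < \<alpha>" and "\<alpha> \<le> 1"
    and "\<forall>T\<in>seqs V. h T \<ge> 0" and "h [] = 0"
    and "forward_monotone V h"
    and "algorithm1_output V h k 1 S"
  shows "(backward_monotone V h \<and> element_sequence_submodular \<mu>1 V h \<and>
            sequence_submodular \<mu>2 V h \<longrightarrow>
          (let a = \<mu>1 * \<mu>2 / (\<mu>1 + 1); b = \<mu>1 * ((real k - 2) / (real k - 1)) in
            robust_value h 1 S \<ge> a * (exp b - 1) / (exp b - a) * robust_opt V h k 1))
       \<and> (approx_backward_monotone \<alpha> V h \<and> element_sequence_submodular \<mu>1 V h \<and>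
            sequence_submodular \<mu>2 V h \<longrightarrow>
          robust_value h 1 S \<ge>
            \<alpha>\<^sup>2 * \<mu>1 * \<mu>2 * (exp \<mu>1 - 1) / ((\<mu>1 + \<alpha>) * exp \<mu>1) * robust_opt V h k 1)"
proof (intro conjI impI)
  assume asm: "backward_monotone V h \<and> element_sequence_submodular \<mu>1 V h \<and>
    sequence_submodular \<mu>2 V h"
  interpret submodular_seq_fun V h \<mu>1 \<mu>2 1
    using assms asm
    by unfold_locales (auto simp: backward_monotone_def approx_backward_monotone_def)
  show "let a = \<mu>1 * \<mu>2 / (\<mu>1 + 1); b = \<mu>1 * ((real k - 2) / (real k - 1)) in
      robust_value h 1 S \<ge> a * (exp b - 1) / (exp b - a) * robust_opt V h k 1"
    unfolding Let_def using assms by (intro algorithm1_ratio_exact_backward) auto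
next
  assume asm: "approx_backward_monotone \<alpha> V h \<and> element_sequence_submodular \<mu>1 V h \<and>
    sequence_submodular \<mu>2 V h"
  interpret submodular_seq_fun V h \<mu>1 \<mu>2 \<alpha>
    using assms asm by unfold_locales auto
  show "robust_value h 1 S \<ge>
      \<alpha>\<^sup>2 * \<mu>1 * \<mu>2 * (exp \<mu>1 - 1) / ((\<mu>1 + \<alpha>) * exp \<mu>1) * robust_opt V h k 1"
    using assms by (intro algorithm1_ratio_approx_backward)
qed

end
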